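(* Let $m\ge 1$ be an integer and let $f_{m,n}(z)=\sum_{j=0}^{n}\binom{n}{j}z^{\binom{j}{m}}$ for $n\ge 0$. Then for all integers $n\ge m$ we have the polynomial identity $$z f'_{m,n}(z)=\binom{n}{m}\sum_{i=0}^{m}\binom{m}{i}(-1)^{i}f_{m,n-i}(z),$$ where $'$ denotes the derivative with respect to $z$.
   Context: Conventions: $\binom{j}{m}=0$ for $0\le j<m$, and $z^0=1$. *)

theory Defs
  imports "HOL-Computational_Algebra.Polynomial"
begin

definition f_poly :: "nat \<Rightarrow> nat \<Rightarrow> 'a :: idom poly" where
  "f_poly m n = (\<Sum>j\<le>n. monom (of_nat (n choose j)) (j choose m))"

end

theory Submission imports Defs begin

text \<open>
  Comparing coefficients of \<open>z ^ (j choose m)\<close>, the alternating sum is the \<open>m\<close>-th backward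
  difference of \<open>n choose j\<close>, which equals \<open>(n - m) choose (j - m)\<close>; the identity is then
  \<open>(n choose m) * ((n - m) choose (j - m)) = (n choose j) * (j choose m)\<close>.
\<close>

text \<open>With \<open>S\<close> the shift of \<open>g\<close>, this is
  \<open>(1 - S) ^ Suc m = (1 - S) ^ m * (1 - S)\<close> evaluated at 0. Pascal's rule splits the
  coefficients.\<close>

lemma alternating_binomial_sum_Suc:
  fixes g :: "nat \<Rightarrow> 'a :: comm_ring_1"
  shows "(\<Sum>i\<le>Suc m. of_nat (Suc m choose i) * (- 1) ^ i * g i) =
    (\<Sum>i\<le>m. of_nat (m choose i) * (- 1) ^ i * (g i - g (Suc i)))"
proof -
  have "(\<Sum>i\<le>Suc m. of_nat (Suc m choose i) * (- 1) ^ i * g i) =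
      g 0 + (\<Sum>i\<le>m. of_nat (m choose Suc i) * (- 1) ^ Suc i * g (Suc i))
        + (\<Sum>i\<le>m. of_nat (m choose i) * (- 1) ^ Suc i * g (Suc i))"
    by (simp add: sum.atMost_Suc_shift algebra_simps flip: sum.distrib del: sum.atMost_Suc)
  \<comment> \<open>\<open>g 0\<close> is the missing term \<open>i = 0\<close>. The top term
    \<open>i = Suc m\<close> is harmless because \<open>m choose Suc m\<close> is 0.\<close>
  also have "g 0 + (\<Sum>i\<le>m. of_nat (m choose Suc i) * (- 1) ^ Suc i * g (Suc i)) =
      (\<Sum>i\<le>Suc m. of_nat (m choose i) * (- 1) ^ i * g i)"
    by (simp add: sum.atMost_Suc_shift del: sum.atMost_Suc)
  also have "\<dots> = (\<Sum>i\<le>m. of_nat (m choose i) * (- 1) ^ i * g i)"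
    by (simp add: binomial_eq_0)
  finally show ?thesis
    by (simp add: right_diff_distrib sum_subtractf sum_negf)
qed

text \<open>By Pascal's rule each difference lowers both arguments of the binomial by one. The case
  \<open>j < m\<close> is separate because truncated \<open>j - m\<close> would give the value 1
  instead of 0.\<close>

lemma backward_difference_binomial:
  assumes "m \<le> n"
  shows "(\<Sum>i\<le>m. of_nat (m choose i) * (- 1) ^ i * of_nat ((n - i) choose j)) =
    (if m \<le> j then of_nat ((n - m) choose (j - m)) else 0 :: 'a :: comm_ring_1)"
  using assms
proof (induction m arbitrary: n)
  case 0
  then show ?case by simp
next
  case (Suc m)
  define D :: "nat \<Rightarrow> 'a" where
    "D k = (\<Sum>i\<le>m. of_nat (m choose i) * (- 1) ^ i * of_nat ((k - i) choose j))" for k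
  obtain p where n: "n = Suc m + p"
    using Suc.prems le_iff_add by blast
  have "(\<Sum>i\<le>Suc m. of_nat (Suc m choose i) * (- 1) ^ i * of_nat ((n - i) choose j)) =
      D n - D (n - 1)"
    by (simp add: alternating_binomial_sum_Suc D_def right_diff_distrib sum_subtractf
        del: sum.atMost_Suc)
  also have "\<dots> = (if Suc m \<le> j then of_nat ((n - Suc m) choose (j - Suc m)) else 0)"
  proof (cases "Suc m \<le> j")
    case True
    then obtain q where "j = Suc m + q"
      using le_iff_add by blast
    \<comment> \<open>What remains is Pascal's rule: \<open>Suc p choose Suc q\<close> minus
      \<open>p choose Suc q\<close> is \<open>p choose q\<close>.\<close>
    then show ?thesis
      using Suc.IH[of n] Suc.IH[of "n - 1"] n by (simp add: D_def Suc_diff_le)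
  next
    case False
    \<comment> \<open>For \<open>j = m\<close> both differences are 1 and cancel; for
      \<open>j < m\<close> both are 0.\<close>
    then show ?thesis
      using Suc.IH[of n] Suc.IH[of "n - 1"] n by (simp add: D_def)
  qed
  finally show ?case .
qed

text \<open>Gives all \<open>f_poly m (n - i)\<close> the same index range, so that the sums over
  \<open>i\<close> and \<open>j\<close> can be exchanged.\<close>

lemma f_poly_extend:
  assumes "k \<le> n"
  shows "f_poly m k = (\<Sum>j\<le>n. of_nat (k choose j) * monom (1 :: 'a :: idom) (j choose m))"
proof -
  have "f_poly m k = (\<Sum>j\<le>k. of_nat (k choose j) * monom (1 :: 'a) (j choose m))"
    by (simp add: f_poly_def of_nat_poly smult_monom)
  also have "\<dots> = (\<Sum>j\<le>n. of_nat (k choose j) * monom 1 (j choose m))"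
    using assms by (intro sum.mono_neutral_left) (simp_all add: binomial_eq_0)
  finally show ?thesis .
qed

text \<open>Monomials are eigenvectors of the Euler operator \<open>z d/dz\<close>. The case
  \<open>k = 0\<close> is split off because the exponent \<open>k - 1\<close> is truncated.\<close>

lemma monom_times_pderiv_monom:
  "monom 1 1 * pderiv (monom c k) = of_nat k * monom (c :: 'a :: idom) k"
  by (cases k) (simp_all add: pderiv_monom mult_monom of_nat_poly smult_monom)

theorem corollary4p1:
  fixes m n :: nat
  assumes "m \<ge> 1" and "n \<ge> m"
  shows "monom 1 1 * pderiv (f_poly m n :: 'a :: idom poly) =
    of_nat (n choose m) * (\<Sum>i\<le>m. of_nat (m choose i) * (- 1) ^ i * f_poly m (n - i))"
proof -
  let ?z = "\<lambda>j. monom (1 :: 'a) (j choose m)"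
  \<comment> \<open>For \<open>j < m\<close> both sides vanish; otherwise \<open>choose_mult\<close>
    applies, as \<open>m \<le> j \<le> n\<close>.\<close>
  have coeff: "of_nat (n choose m) *
      (\<Sum>i\<le>m. of_nat (m choose i) * (- 1) ^ i * of_nat ((n - i) choose j)) =
      (of_nat ((n choose j) * (j choose m)) :: 'a poly)" if "j \<le> n" for j
    using that assms(2) choose_mult[of m j n]
    by (simp add: backward_difference_binomial binomial_eq_0 flip: of_nat_mult)
  have "(\<Sum>i\<le>m. of_nat (m choose i) * (- 1) ^ i * f_poly m (n - i)) =
      (\<Sum>i\<le>m. \<Sum>j\<le>n. of_nat (m choose i) * (- 1) ^ i * of_nat ((n - i) choose j) * ?z j)"
    by (simp add: f_poly_extend[of _ n] sum_distrib_left mult.assoc)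
  also have "\<dots> =
      (\<Sum>j\<le>n. (\<Sum>i\<le>m. of_nat (m choose i) * (- 1) ^ i * of_nat ((n - i) choose j)) * ?z j)"
    by (subst sum.swap) (simp add: sum_distrib_right)
  finally have "of_nat (n choose m) *
      (\<Sum>i\<le>m. of_nat (m choose i) * (- 1) ^ i * f_poly m (n - i)) =
      (\<Sum>j\<le>n. of_nat (n choose m) *
        (\<Sum>i\<le>m. of_nat (m choose i) * (- 1) ^ i * of_nat ((n - i) choose j)) * ?z j)"
    by (simp add: sum_distrib_left[of _ _ "{..n}"] mult.assoc)
  also have "\<dots> = (\<Sum>j\<le>n. of_nat ((n choose j) * (j choose m)) * ?z j)"
    by (simp add: coeff del: of_nat_mult)
  also have "\<dots> = monom 1 1 * pderiv (f_poly m n)"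
    \<comment> \<open>The rule for iterated derivatives, taken at order 1, moves
      \<open>pderiv\<close> inside the sum.\<close>
    unfolding f_poly_def higher_pderiv_sum[of 1, simplified] sum_distrib_left
      monom_times_pderiv_monom
    by (simp add: of_nat_poly smult_monom mult.commute)
  finally show ?thesis ..
qed

end
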